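(* Let $(L,\leq,0,1)$ be a bounded lattice with $e\in L\setminus\{0,1\}$. (i) Let $T_e$ be a $t$-norm on $[0,e]$ and let $R$ be a $t$-subconorm on $L$. Suppose $x\parallel y$ for all $x\in I_e$ and $y\in[e,1[$. Then the function $U_5:L^2\to L$ defined by $$U_5(x,y)=\begin{cases} T_e(x,y) & \text{if }(x,y)\in[0,e]^2,\\ x\wedge y & \text{if }(x,y)\in[0,e[\,\times I_e\cup I_e\times[0,e[\,\cup[0,e[\,\times\,]e,1]\cup\,]e,1]\times[0,e[,\\ y & \text{if }(x,y)\in\{e\}\times I_e\cup\{e\}\times\,]e,1],\\ x & \text{if }(x,y)\in I_e\times\{e\}\cup\,]e,1]\times\{e\},\\ R(x,y) & \text{if }(x,y)\in I_e^2,\\ 1 & \text{if }(x,y)\in I_e\times\,]e,1]\cup\,]e,1]\times I_e\cup\,]e,1]^2\end{cases}$$ is a uninorm on $L$ with neutral element $e$ if and only if $x>y$ for all $x\in I_e$ and $y\in[0,e[$. (ii) Let $S_e$ be a $t$-conorm on $[e,1]$ and let $F$ be a $t$-subnorm on $L$. Suppose $x\parallel y$ for all $x\in I_e$ and $y\in\,]0,e]$. Then the function $U_6:L^2\to L$ defined by $$U_6(x,y)=\begin{cases} S_e(x,y) & \text{if }(x,y)\in[e,1]^2,\\ x\vee y & \text{if }(x,y)\in\,]e,1]\times I_e\cup I_e\times\,]e,1]\cup[0,e[\,\times\,]e,1]\cup\,]e,1]\times[0,e[,\\ y & \text{if }(x,y)\in\{e\}\times I_e\cup\{e\}\times[0,e[,\\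 x & \text{if }(x,y)\in I_e\times\{e\}\cup[0,e[\,\times\{e\},\\ F(x,y) & \text{if }(x,y)\in I_e^2,\\ 0 & \text{if }(x,y)\in I_e\times[0,e[\,\cup[0,e[\,\times I_e\cup[0,e[^2\end{cases}$$ is a uninorm on $L$ with neutral element $e$ if and only if $x<y$ for all $x\in I_e$ and $y\in\,]e,1]$.
   Context: A bounded lattice $(L,\leq,0,1)$ is a lattice with bottom element $0$ and top element $1$. For $a\le b$ in $L$: $[a,b]=\{x\in L: a\le x\le b\}$, $[a,b[\,=\{x: a\le x<b\}$, $]a,b]=\{x: a<x\le b\}$, $]a,b[\,=\{x: a<x<b\}$. Write $x\parallel y$ if $x$ and $y$ are incomparable, and $I_e=\{x\in L: x\parallel e\}$. A $t$-norm (resp. $t$-conorm) on a bounded lattice is a binary operation on it that is commutative, associative, increasing in both variables, and has the top (resp. bottom) element of that lattice as neutral element; so a $t$-norm on $[0,e]$ has neutral element $e$, and a $t$-conorm on $[e,1]$ has neutral element $e$. A $t$-subnorm on $L$ is a commutative, associative operation $F:L^2\to L$, increasing in both variables, with $F(x,y)\le x\wedge y$ for all $x,y\in L$. A $t$-subconorm on $L$ is a commutative, associative operation $R:L^2\to L$, increasing in both variables, with $R(x,y)\ge x\vee y$ for all $x,y\in L$. A uninorm on $L$ with neutral element $e\in L$ is a map $U:L^2\to L$ that is commutative, associative, increasing in both variables, and satisfies $U(e,x)=x$ for all $x\in L$. *)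

theory Defs imports Main begin

definition incomparable :: "'a::order \<Rightarrow> 'a \<Rightarrow> bool" (infix "\<parallel>" 50)
  where "x \<parallel> y \<longleftrightarrow> \<not> x \<le> y \<and> \<not> y \<le> x"

definition incomparables :: "'a::order \<Rightarrow> 'a set"
  where "incomparables e = {x. x \<parallel> e}"

text \<open>Increasing is meant in the weak sense, i.e. order preserving.\<close>

definition comm_assoc_incr_on :: "'a::order set \<Rightarrow> ('a \<Rightarrow> 'a \<Rightarrow> 'a) \<Rightarrow> bool"
  where "comm_assoc_incr_on A f \<longleftrightarrow>
    (\<forall>x\<in>A. \<forall>y\<in>A. f x y \<in> A) \<and>
    (\<forall>x\<in>A. \<forall>y\<in>A. f x y = f y x) \<and>
    (\<forall>x\<in>A. \<forall>y\<in>A. \<forall>z\<in>A. f (f x y) z = f x (f y z)) \<and>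
    (\<forall>y\<in>A. mono_on A (\<lambda>x. f x y)) \<and>
    (\<forall>x\<in>A. mono_on A (\<lambda>y. f x y))"

text \<open>Operations on the bounded lattice \<open>[a, b]\<close> are total functions on the ambient type,
  of which only the values on \<open>[a, b] \<times> [a, b]\<close> matter.\<close>

definition t_norm_on :: "'a::lattice \<Rightarrow> 'a \<Rightarrow> ('a \<Rightarrow> 'a \<Rightarrow> 'a) \<Rightarrow> bool"
  where "t_norm_on a b T \<longleftrightarrow> comm_assoc_incr_on {a..b} T \<and> (\<forall>x\<in>{a..b}. T b x = x)"

definition t_conorm_on :: "'a::lattice \<Rightarrow> 'a \<Rightarrow> ('a \<Rightarrow> 'a \<Rightarrow> 'a) \<Rightarrow> bool"
  where "t_conorm_on a b S \<longleftrightarrow> comm_assoc_incr_on {a..b} S \<and> (\<forall>x\<in>{a..b}. S a x = x)"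

definition t_subnorm :: "('a::bounded_lattice \<Rightarrow> 'a \<Rightarrow> 'a) \<Rightarrow> bool"
  where "t_subnorm F \<longleftrightarrow> comm_assoc_incr_on UNIV F \<and> (\<forall>x y. F x y \<le> inf x y)"

definition t_subconorm :: "('a::bounded_lattice \<Rightarrow> 'a \<Rightarrow> 'a) \<Rightarrow> bool"
  where "t_subconorm R \<longleftrightarrow> comm_assoc_incr_on UNIV R \<and> (\<forall>x y. sup x y \<le> R x y)"

definition uninorm :: "'a::bounded_lattice \<Rightarrow> ('a \<Rightarrow> 'a \<Rightarrow> 'a) \<Rightarrow> bool"
  where "uninorm e U \<longleftrightarrow> comm_assoc_incr_on UNIV U \<and> (\<forall>x. U e x = x)"

text \<open>In the next two definitions the regions are pairwise disjoint, and the final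
  \<open>else\<close> covers exactly the region stated in the lemma that follows.\<close>

definition U5 :: "'a::bounded_lattice \<Rightarrow> ('a \<Rightarrow> 'a \<Rightarrow> 'a) \<Rightarrow> ('a \<Rightarrow> 'a \<Rightarrow> 'a) \<Rightarrow> 'a \<Rightarrow> 'a \<Rightarrow> 'a"
  where "U5 e T R x y =
   (let I = incomparables e in
    if (x, y) \<in> {bot..e} \<times> {bot..e} then T x y
    else if (x, y) \<in> {bot..<e} \<times> I \<union> I \<times> {bot..<e}
                   \<union> {bot..<e} \<times> {e<..top} \<union> {e<..top} \<times> {bot..<e} then inf x y
    else if (x, y) \<in> {e} \<times> I \<union> {e} \<times> {e<..top} then y
    else if (x, y) \<in> I \<times> {e} \<union> {e<..top} \<times> {e} then x
    else if (x, y) \<in> I \<times> I then R x y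
    else top)"

lemma U5_eq_top:
  assumes "(x, y) \<in> incomparables e \<times> {e<..top} \<union> {e<..top} \<times> incomparables e
                   \<union> {e<..top} \<times> {e<..top}"
  shows "U5 e T R x y = top"
  using assms by (auto simp: less_le_not_le U5_def incomparables_def incomparable_def Let_def)

lemma U5_regions_exhaustive:
  "(x, y) \<in> {bot..e} \<times> {bot..e}
     \<union> ({bot..<e} \<times> incomparables e \<union> incomparables e \<times> {bot..<e}
        \<union> {bot..<e} \<times> {e<..top} \<union> {e<..top} \<times> {bot..<e})
     \<union> ({e} \<times> incomparables e \<union> {e} \<times> {e<..top})
     \<union> (incomparables e \<times> {e} \<union> {e<..top} \<times> {e})
     \<union> incomparables e \<times> incomparables e
     \<union> (incomparables e \<times> {e<..top} \<union> {e<..top} \<times> incomparables e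
        \<union> {e<..top} \<times> {e<..top})" for e :: "'a::bounded_lattice"
  by (auto simp: incomparables_def incomparable_def less_le)

definition U6 :: "'a::bounded_lattice \<Rightarrow> ('a \<Rightarrow> 'a \<Rightarrow> 'a) \<Rightarrow> ('a \<Rightarrow> 'a \<Rightarrow> 'a) \<Rightarrow> 'a \<Rightarrow> 'a \<Rightarrow> 'a"
  where "U6 e S F x y =
   (let I = incomparables e in
    if (x, y) \<in> {e..top} \<times> {e..top} then S x y
    else if (x, y) \<in> {e<..top} \<times> I \<union> I \<times> {e<..top}
                   \<union> {bot..<e} \<times> {e<..top} \<union> {e<..top} \<times> {bot..<e} then sup x y
    else if (x, y) \<in> {e} \<times> I \<union> {e} \<times> {bot..<e} then y
    else if (x, y) \<in> I \<times> {e} \<union> {bot..<e} \<times> {e} then x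
    else if (x, y) \<in> I \<times> I then F x y
    else bot)"

lemma U6_eq_bot:
  assumes "(x, y) \<in> incomparables e \<times> {bot..<e} \<union> {bot..<e} \<times> incomparables e
                   \<union> {bot..<e} \<times> {bot..<e}"
  shows "U6 e S F x y = bot"
  using assms by (auto simp: less_le_not_le U6_def incomparables_def incomparable_def Let_def)

lemma U6_regions_exhaustive:
  "(x, y) \<in> {e..top} \<times> {e..top}
     \<union> ({e<..top} \<times> incomparables e \<union> incomparables e \<times> {e<..top}
        \<union> {bot..<e} \<times> {e<..top} \<union> {e<..top} \<times> {bot..<e})
     \<union> ({e} \<times> incomparables e \<union> {e} \<times> {bot..<e})
     \<union> (incomparables e \<times> {e} \<union> {bot..<e} \<times> {e})
     \<union> incomparables e \<times> incomparables e
     \<union> (incomparables e \<times> {bot..<e} \<union> {bot..<e} \<times> incomparables e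
        \<union> {bot..<e} \<times> {bot..<e})" for e :: "'a::bounded_lattice"
  by (auto simp: incomparables_def incomparable_def less_le)

end

theory Submission imports Defs "HOL-Library.Dual_Ordered_Lattice" begin

text \<open>If every element of \<open>I\<^sub>e\<close> dominates \<open>[0, e[\<close>, then so does the whole complement \<open>K\<close> of
  \<open>[0, e]\<close>, and \<open>U\<^sub>5\<close> is an ordinal-sum-like gluing of \<open>T\<^sub>e\<close> on \<open>[0, e]\<close> with the operation on \<open>K\<close>
  that equals \<open>R\<close> on \<open>I\<^sub>e\<close> and \<open>1\<close> elsewhere; such a gluing is a uninorm as soon as the operation
  on \<open>K\<close> is commutative, associative, increasing and lies above the join. Incomparability of
  \<open>I\<^sub>e\<close> and \<open>[e, 1[\<close> forces \<open>R(x, y) \<in> I\<^sub>e \<union> {1}\<close> for \<open>x, y \<in> I\<^sub>e\<close>, which gives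
  associativity on \<open>K\<close>. Conversely, associativity at \<open>(x, 1, y)\<close> yields \<open>y = x \<and> y\<close>. Part (ii) is
  part (i) in the dual lattice.\<close>

section \<open>Operations on a subset and bounds for t-norms\<close>

lemma comm_assoc_incr_onI:
  assumes "\<And>x y. x \<in> A \<Longrightarrow> y \<in> A \<Longrightarrow> f x y \<in> A"
    and "\<And>x y. x \<in> A \<Longrightarrow> y \<in> A \<Longrightarrow> f x y = f y x"
    and "\<And>x y z. x \<in> A \<Longrightarrow> y \<in> A \<Longrightarrow> z \<in> A \<Longrightarrow> f (f x y) z = f x (f y z)"
    and "\<And>x x' y. x \<in> A \<Longrightarrow> x' \<in> A \<Longrightarrow> y \<in> A \<Longrightarrow> x \<le> x' \<Longrightarrow> f x y \<le> f x' y"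
  shows "comm_assoc_incr_on A f"
proof -
  \<comment> \<open>Commutativity carries monotonicity in the first argument over to the
    second.\<close>
  have "f y x \<le> f y x'" if "x \<in> A" "x' \<in> A" "y \<in> A" "x \<le> x'" for x x' y
    using assms(2)[of y x] assms(2)[of y x'] assms(4)[of x x' y] that by simp
  then show ?thesis
    unfolding comm_assoc_incr_on_def mono_on_def
    by (intro conjI ballI allI impI) (auto intro: assms)
qed

lemma comm_assoc_incr_onD:
  assumes "comm_assoc_incr_on A f"
  shows "x \<in> A \<Longrightarrow> y \<in> A \<Longrightarrow> f x y \<in> A"
    and "x \<in> A \<Longrightarrow> y \<in> A \<Longrightarrow> f x y = f y x"
    and "x \<in> A \<Longrightarrow> y \<in> A \<Longrightarrow> z \<in> A \<Longrightarrow> f (f x y) z = f x (f y z)"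
    and "x \<in> A \<Longrightarrow> x' \<in> A \<Longrightarrow> y \<in> A \<Longrightarrow> x \<le> x' \<Longrightarrow> f x y \<le> f x' y"
  using assms unfolding comm_assoc_incr_on_def mono_on_def by blast+

text \<open>Each factor is bounded by the neutral element \<open>b\<close>, so monotonicity gives
  \<open>T u v \<le> T b v = v\<close>; commutativity gives the other bound.\<close>

lemma t_norm_on_le:
  assumes "t_norm_on a b T" "x \<in> {a..b}" "y \<in> {a..b}"
  shows "T x y \<le> x" "T x y \<le> y"
proof -
  have c: "comm_assoc_incr_on {a..b} T" and n: "\<And>x. x \<in> {a..b} \<Longrightarrow> T b x = x"
    using assms(1) by (auto simp: t_norm_on_def)
  have b: "b \<in> {a..b}"
    using assms(2) by auto
  have *: "T u v \<le> v" if "u \<in> {a..b}" "v \<in> {a..b}" for u v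
    using comm_assoc_incr_onD(4)[OF c that(1) b that(2)] n[OF that(2)] that by simp
  show "T x y \<le> y" "T x y \<le> x"
    using * assms comm_assoc_incr_onD(2)[OF c] by metis+
qed

section \<open>Gluing a t-norm on \<open>{bot..e}\<close> to an operation outside
  \<open>{..e}\<close>\<close>

definition glue :: "'a::order \<Rightarrow> ('a \<Rightarrow> 'a \<Rightarrow> 'a) \<Rightarrow> ('a \<Rightarrow> 'a \<Rightarrow> 'a) \<Rightarrow> 'a \<Rightarrow> 'a \<Rightarrow> 'a"
  where "glue e T V x y =
    (if x \<le> e \<and> y \<le> e then T x y
     else if x < e then x else if y < e then y
     else if x = e then y else if y = e then x
     else V x y)"

text \<open>A mixed product returns its argument strictly below \<open>e\<close>, so in a triple
  with some arguments there and others outside \<open>{..e}\<close> both bracketings reduce to the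
  \<open>T\<close>-product of the lower ones. The order between the two pieces,
  \<open>below\<close>, enters through monotonicity.\<close>

lemma uninorm_glue:
  fixes e :: "'a::bounded_lattice"
  assumes T: "t_norm_on bot e T"
    and V: "comm_assoc_incr_on (- {..e}) V"
    and V_ge: "\<And>x y. \<not> x \<le> e \<Longrightarrow> \<not> y \<le> e \<Longrightarrow> sup x y \<le> V x y"
    and below: "\<And>x y. \<not> x \<le> e \<Longrightarrow> y < e \<Longrightarrow> y \<le> x"
  shows "uninorm e (glue e T V)"
proof -
  let ?U = "glue e T V"
  have Tc: "comm_assoc_incr_on {bot..e} T" and Te: "x \<le> e \<Longrightarrow> T e x = x" for x
    using T by (auto simp: t_norm_on_def)
  have T_cl: "T x y \<le> e" and T_comm: "T x y = T y x"
    and T_le: "T x y \<le> x" "T x y \<le> y" if "x \<le> e" "y \<le> e" for x y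
    using that t_norm_on_le[OF T, of x y] comm_assoc_incr_onD(1,2)[OF Tc, of x y] by auto
  have T_assoc: "T (T x y) z = T x (T y z)" if "x \<le> e" "y \<le> e" "z \<le> e" for x y z
    using that comm_assoc_incr_onD(3)[OF Tc] by auto
  have T_mono: "T x z \<le> T y z" if "x \<le> y" "y \<le> e" "z \<le> e" for x y z
    using that comm_assoc_incr_onD(4)[OF Tc] by auto
  have V_cl: "\<not> V x y \<le> e" and V_comm: "V x y = V y x" and V_le: "x \<le> V x y" "y \<le> V x y"
    if "\<not> x \<le> e" "\<not> y \<le> e" for x y
    using that V_ge[of x y] comm_assoc_incr_onD(1,2)[OF V, of x y] by auto
  have V_assoc: "V (V x y) z = V x (V y z)" if "\<not> x \<le> e" "\<not> y \<le> e" "\<not> z \<le> e" for x y z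
    using that comm_assoc_incr_onD(3)[OF V] by auto
  have V_mono: "V x z \<le> V y z" if "x \<le> y" "\<not> x \<le> e" "\<not> y \<le> e" "\<not> z \<le> e" for x y z
    using that comm_assoc_incr_onD(4)[OF V] by auto
  have [simp]: "x \<le> e \<Longrightarrow> T x e = x" for x
    using T_comm[of x e] Te[of x] by simp
  \<comment> \<open>Strictness keeps a partial product absorbing towards arguments outside
    \<open>{..e}\<close>; the value \<open>e\<close> would act neutrally instead.\<close>
  have [simp]: "x < e \<Longrightarrow> y \<le> e \<Longrightarrow> T x y < e" "x \<le> e \<Longrightarrow> y < e \<Longrightarrow> T x y < e" for x y
    by (meson T_le le_less_trans less_imp_le)+
  have U_e: "?U e x = x" for x
    using Te by (auto simp: glue_def)
  have U_comm: "?U x y = ?U y x" for x y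
    using T_comm V_comm by (auto simp: glue_def)
  have U_TT: "?U x y = T x y" if "x \<le> e" "y \<le> e" for x y
    using that by (simp add: glue_def)
  have U_lt: "?U x y = x" "?U y x = x" if "x < e" "\<not> y \<le> e" for x y
    using that by (auto simp: glue_def)
  have U_VV: "?U x y = V x y" if "\<not> x \<le> e" "\<not> y \<le> e" for x y
    using that by (auto simp: glue_def)
  have U_e': "?U x e = x" for x
    using U_e U_comm by metis
  have U_assoc: "?U (?U x y) z = ?U x (?U y z)" for x y z
  proof -
    consider "x = e \<or> y = e \<or> z = e" | "x \<noteq> e" "y \<noteq> e" "z \<noteq> e" by blast
    then show ?thesis
    proof cases
      case 1
      then show ?thesis by (auto simp: U_e U_e')
    next
      case 2
      then have *: "x < e \<or> \<not> x \<le> e" "y < e \<or> \<not> y \<le> e" "z < e \<or> \<not> z \<le> e" by auto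
      show ?thesis
        using * by (elim disjE) (simp_all add: U_TT U_lt U_VV T_assoc V_assoc V_cl T_cl less_imp_le)
    qed
  qed
  have U_mono: "?U x z \<le> ?U y z" if xy: "x \<le> y" for x y z
  proof (cases "z \<le> e")
    case z: True
    consider "z = e" | "z < e" "y \<le> e" | "z < e" "x \<le> e" "\<not> y \<le> e"
      | "z < e" "\<not> x \<le> e" "\<not> y \<le> e"
      using z xy by fastforce
    then show ?thesis
    proof cases
      case 2
      then show ?thesis using xy T_mono by (simp add: U_TT)
    next
      case 3
      then show ?thesis using T_le by (simp add: U_TT U_lt)
    qed (use xy in \<open>simp_all add: U_e' U_lt\<close>)
  next
    case z: False
    consider "y < e" | "y = e" "x = e" | "y = e" "x < e" | "\<not> y \<le> e" "x < e"
      | "\<not> y \<le> e" "x = e" | "\<not> y \<le> e" "\<not> x \<le> e"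
      using xy by fastforce
    then show ?thesis
    proof cases
      case 1
      then have "x < e" using xy by simp
      with 1 z xy show ?thesis by (simp add: U_lt)
    next
      case 3
      \<comment> \<open>The claim is \<open>x \<le> z\<close>: the left side is a mixed product,
        while \<open>e\<close> acts neutrally on \<open>z\<close>.\<close>
      then show ?thesis using z below by (simp add: U_lt U_e)
    next
      case 4
      then show ?thesis using z xy V_le(1)[of y z] by (simp add: U_lt U_VV)
    next
      case 5
      then show ?thesis using z V_le by (simp add: U_e U_VV)
    next
      case 6
      then show ?thesis using z xy V_mono by (simp add: U_VV)
    qed simp
  qed
  show ?thesis
    unfolding uninorm_def
    using U_e by (intro conjI comm_assoc_incr_onI) (auto intro: U_comm U_assoc U_mono)
qed

section \<open>\<open>U5\<close> as a glued operation\<close>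

lemma U5_eq_glue:
  fixes e :: "'a::bounded_lattice"
  assumes "\<And>x y. x \<parallel> e \<Longrightarrow> y < e \<Longrightarrow> y < x"
  shows "U5 e T R = glue e T (\<lambda>x y. if x \<parallel> e \<and> y \<parallel> e then R x y else top)"
proof (intro ext)
  fix x y
  \<comment> \<open>The hypothesis makes each meet of the mixed region equal to its lower argument,
    the value that \<open>glue\<close> returns.\<close>
  have i: "inf x y = x" if "x < e" "y \<parallel> e \<or> e < y" for x y
    using that assms[of y x] by (auto intro!: inf_absorb1)
  have i': "inf x y = y" if "y < e" "x \<parallel> e \<or> e < x" for x y
    using i[OF that] by (simp add: inf_commute)
  \<comment> \<open>Each alternative settles every comparison with \<open>e\<close>, so
    simplification decides all branches in the sixteen combinations.\<close>
  have tri: "z < e \<and> z \<le> e \<and> z \<noteq> e \<and> \<not> e < z \<and> \<not> z \<parallel> e \<or> z = e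
      \<or> e < z \<and> \<not> z < e \<and> \<not> z \<le> e \<and> z \<noteq> e \<and> \<not> z \<parallel> e
      \<or> z \<parallel> e \<and> \<not> z < e \<and> \<not> z \<le> e \<and> z \<noteq> e \<and> \<not> e < z" for z
    by (auto simp: incomparable_def less_le)
  show "U5 e T R x y = glue e T (\<lambda>x y. if x \<parallel> e \<and> y \<parallel> e then R x y else top) x y"
    using tri[of x] tri[of y]
    by (elim disjE conjE) (simp_all add: U5_def glue_def incomparables_def i i')
qed

text \<open>\<open>top\<close> absorbs both for \<open>R\<close> and for the truncated operation,
  and \<open>R\<close> leaves the elements incomparable with \<open>e\<close> only at
  \<open>top\<close>; so truncation does not disturb associativity.\<close>

lemma comm_assoc_incr_on_above:
  fixes e :: "'a::bounded_lattice"
  assumes "e \<noteq> top" and R: "t_subconorm R"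
    and par: "\<And>x y. x \<parallel> e \<Longrightarrow> e \<le> y \<Longrightarrow> y < top \<Longrightarrow> x \<parallel> y"
  shows "comm_assoc_incr_on (- {..e}) (\<lambda>x y. if x \<parallel> e \<and> y \<parallel> e then R x y else top)"
proof -
  have Rc: "comm_assoc_incr_on UNIV R" and R_le: "x \<le> R x y" "y \<le> R x y" for x y
    using R by (auto simp: t_subconorm_def)
  note R_comm = comm_assoc_incr_onD(2)[OF Rc UNIV_I UNIV_I]
    and R_assoc = comm_assoc_incr_onD(3)[OF Rc UNIV_I UNIV_I UNIV_I]
    and R_mono = comm_assoc_incr_onD(4)[OF Rc UNIV_I UNIV_I UNIV_I]
  \<comment> \<open>An element above \<open>x\<close> and comparable with \<open>e\<close> lies
    above \<open>e\<close>, since otherwise \<open>x \<le> e\<close>; by \<open>par\<close> it can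
    then only be \<open>top\<close>.\<close>
  have up: "y = top" if "x \<parallel> e" "x \<le> y" "\<not> y \<parallel> e" for x y
  proof (rule ccontr)
    assume "y \<noteq> top"
    moreover have "e \<le> y"
      using that by (auto simp: incomparable_def)
    ultimately show False
      using par[of x y] that by (auto simp: incomparable_def less_top)
  qed
  have top: "\<not> top \<le> e" "\<not> top \<parallel> e"
    using \<open>e \<noteq> top\<close> by (auto simp: incomparable_def top_unique)
  have R_top: "R top z = top" "R z top = top" for z
    using R_le[of top z] R_le[of z top] by (auto simp: top_unique)
  have R_par: "R x y = top" if "x \<parallel> e" "\<not> R x y \<parallel> e" for x y
    using up that R_le(1) by blast
  have R_above: "\<not> R x y \<le> e" if "x \<parallel> e" for x y
    using that R_le(1)[of x y] order_trans by (auto simp: incomparable_def)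
  show ?thesis
  proof (rule comm_assoc_incr_onI)
    fix x y z
    let ?V = "\<lambda>x y. if x \<parallel> e \<and> y \<parallel> e then R x y else top"
    show "?V (?V x y) z = ?V x (?V y z)"
    proof (cases "x \<parallel> e \<and> y \<parallel> e \<and> z \<parallel> e")
      case True
      \<comment> \<open>If just one inner product is \<open>top\<close>, associativity of
        \<open>R\<close> and \<open>R_top\<close> force the other bracketing to be
        \<open>top\<close> too.\<close>
      then show ?thesis
        using R_par[of x y] R_par[of y z] R_assoc[of x y z] R_top top by auto
    next
      case False
      then show ?thesis using top by auto
    qed
  next
    fix x x' y
    assume "x \<le> x'" "x' \<in> - {..e}" "x \<in> - {..e}"
    \<comment> \<open>Going up can leave the elements incomparable with \<open>e\<close> but not
      enter them from above \<open>e\<close>, so the value can only switch to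
      \<open>top\<close>.\<close>
    moreover from this have "x \<parallel> e" if "x' \<parallel> e"
      using that order_trans by (auto simp: incomparable_def)
    ultimately show "(if x \<parallel> e \<and> y \<parallel> e then R x y else top)
        \<le> (if x' \<parallel> e \<and> y \<parallel> e then R x' y else top)"
      using R_mono by auto
  qed (use R_comm R_above top in auto)
qed

section \<open>The characterization for \<open>U5\<close>\<close>

lemma uninorm_U5_iff:
  fixes e :: "'a::bounded_lattice"
  assumes "e \<noteq> top" and T: "t_norm_on bot e T" and R: "t_subconorm R"
    and par: "\<forall>x\<in>incomparables e. \<forall>y\<in>{e..<top}. x \<parallel> y"
  shows "uninorm e (U5 e T R) \<longleftrightarrow> (\<forall>x\<in>incomparables e. \<forall>y\<in>{bot..<e}. x > y)"
proof
  assume U: "uninorm e (U5 e T R)"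
  show "\<forall>x\<in>incomparables e. \<forall>y\<in>{bot..<e}. x > y"
  proof (intro ballI)
    fix x y
    assume x: "x \<in> incomparables e" and y: "y \<in> {bot..<e}"
    let ?U = "U5 e T R"
    have top: "e < top"
      using \<open>e \<noteq> top\<close> by (simp add: less_top)
    \<comment> \<open>\<open>top\<close> serves as middle argument because it is sure to lie in
      \<open>{e<..top}\<close>: it absorbs \<open>x\<close> but is itself absorbed by
      \<open>y\<close>.\<close>
    have "?U x top = top"
      using x top by (intro U5_eq_top) auto
    moreover have "?U top y = y"
      using y top by (auto simp: U5_def Let_def incomparables_def incomparable_def top_unique)
    moreover have "?U x y = inf x y"
      using x y by (simp add: U5_def Let_def incomparables_def incomparable_def)
    moreover have "?U (?U x top) y = ?U x (?U top y)"
      using U comm_assoc_incr_onD(3)[of UNIV ?U] by (simp add: uninorm_def)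
    ultimately have "y = inf x y" by simp
    then have "y \<le> x"
      by (metis inf.cobounded1)
    moreover have "y \<noteq> x"
      using x y by (auto simp: incomparables_def incomparable_def)
    ultimately show "x > y" by simp
  qed
next
  assume "\<forall>x\<in>incomparables e. \<forall>y\<in>{bot..<e}. x > y"
  then have lt: "y < x" if "x \<parallel> e" "y < e" for x y
    using that by (simp add: incomparables_def)
  have *: "x \<parallel> e \<or> e < x" if "\<not> x \<le> e" for x
    using that by (auto simp: incomparable_def less_le)
  have eq: "U5 e T R = glue e T (\<lambda>x y. if x \<parallel> e \<and> y \<parallel> e then R x y else top)"
    using lt by (rule U5_eq_glue)
  show "uninorm e (U5 e T R)"
    unfolding eq
  proof (rule uninorm_glue[OF T comm_assoc_incr_on_above[OF \<open>e \<noteq> top\<close> R]])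
    show "x \<parallel> y" if "x \<parallel> e" "e \<le> y" "y < top" for x y
      using bspec[OF bspec[OF par, of x], of y] that by (simp add: incomparables_def)
    show "sup x y \<le> (if x \<parallel> e \<and> y \<parallel> e then R x y else top)" for x y
      using R by (auto simp: t_subconorm_def)
    show "y \<le> x" if "\<not> x \<le> e" "y < e" for x y
      using *[OF that(1)] lt that(2) by (auto intro: less_imp_le)
  qed
qed

section \<open>Transfer to the dual lattice\<close>

definition dual_op :: "('a \<Rightarrow> 'a \<Rightarrow> 'a) \<Rightarrow> 'a dual \<Rightarrow> 'a dual \<Rightarrow> 'a dual"
  where "dual_op f x y = dual (f (undual x) (undual y))"

lemma dual_op_dual [simp]: "dual_op f (dual x) (dual y) = dual (f x y)"
  by (simp add: dual_op_def)

lemma all_dual: "(\<forall>x. P x) \<longleftrightarrow> (\<forall>x. P (dual x))"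
  by (metis dual_undual)

lemma dual_mem_interval [simp]:
  "dual x \<in> {dual b..dual a} \<longleftrightarrow> x \<in> {a..b}"
  "dual x \<in> {dual b..<dual a} \<longleftrightarrow> x \<in> {a<..b}"
  "dual x \<in> {dual b<..dual a} \<longleftrightarrow> x \<in> {a..<b}"
  by auto

lemma incomparable_dual [simp]: "dual x \<parallel> dual y \<longleftrightarrow> x \<parallel> y"
  by (auto simp: incomparable_def)

lemma dual_mem_incomparables [simp]: "dual x \<in> incomparables (dual e) \<longleftrightarrow> x \<in> incomparables e"
  by (simp add: incomparables_def)

text \<open>The order is reversed in both argument and value, and the two reversals cancel.\<close>

lemma mono_on_dual: "mono_on (dual ` A) g \<longleftrightarrow> mono_on A (\<lambda>x. undual (g (dual x)))"
  by (auto simp: mono_on_def dual_less_eq_iff)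

lemma comm_assoc_incr_on_dual_op:
  "comm_assoc_incr_on (dual ` A) (dual_op f) \<longleftrightarrow> comm_assoc_incr_on A f"
  by (simp add: comm_assoc_incr_on_def mono_on_dual inj_image_mem_iff[OF inj_dual])

lemma comm_assoc_incr_on_UNIV_dual_op:
  "comm_assoc_incr_on UNIV (dual_op f) \<longleftrightarrow> comm_assoc_incr_on UNIV f"
  using comm_assoc_incr_on_dual_op[of UNIV f] by (simp add: surj_dual)

lemma dual_image_atLeastAtMost: "dual ` {a..b} = {dual b..dual a}"
proof (intro set_eqI)
  fix x
  show "x \<in> dual ` {a..b} \<longleftrightarrow> x \<in> {dual b..dual a}"
    using dual_mem_interval(1)[of "undual x" b a]
      inj_image_mem_iff[OF inj_dual, of "undual x" "{a..b}"] by simp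
qed

lemma t_norm_on_dual_op: "t_norm_on (dual b) (dual a) (dual_op S) \<longleftrightarrow> t_conorm_on a b S"
  unfolding t_norm_on_def t_conorm_on_def dual_image_atLeastAtMost[symmetric]
  by (simp only: comm_assoc_incr_on_dual_op) (simp add: ball_simps)

lemma t_subconorm_dual_op: "t_subconorm (dual_op F) \<longleftrightarrow> t_subnorm F"
  unfolding t_subconorm_def t_subnorm_def comm_assoc_incr_on_UNIV_dual_op
  by (simp add: all_dual flip: dual_inf_eq)

lemma uninorm_dual_op: "uninorm (dual e) (dual_op U) \<longleftrightarrow> uninorm e U"
  unfolding uninorm_def comm_assoc_incr_on_UNIV_dual_op by (simp add: all_dual)

text \<open>Duality exchanges the intervals on the two sides of \<open>e\<close>, meets with joins
  and \<open>top\<close> with \<open>bot\<close>, which matches the two case lists.\<close>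

lemma U5_dual_op:
  fixes e :: "'a::bounded_lattice"
  shows "U5 (dual e) (dual_op S) (dual_op F) = dual_op (U6 e S F)"
proof (intro ext)
  fix x y :: "'a dual"
  obtain a b where "x = dual a" "y = dual b"
    by (metis dual_undual)
  then show "U5 (dual e) (dual_op S) (dual_op F) x y = dual_op (U6 e S F) x y"
    \<comment> \<open>After dualizing, the last two products of the second case appear in opposite
      orders; \<open>disj_ac\<close> reconciles them.\<close>
    by (simp only: U5_def U6_def Let_def dual_op_dual if_distrib[of dual] Un_iff mem_Times_iff
        fst_conv snd_conv singleton_iff eq_dual_iff dual_mem_interval dual_mem_incomparables
        dual_top_eq[symmetric] dual_bot_eq[symmetric] dual_sup_eq[symmetric] disj_ac)
qed

theorem theorem3p3:
  fixes e :: "'a::bounded_lattice"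
  assumes "e \<noteq> bot" and "e \<noteq> top"
  shows "(\<forall>T R. t_norm_on bot e T \<longrightarrow> t_subconorm R \<longrightarrow>
            (\<forall>x\<in>incomparables e. \<forall>y\<in>{e..<top}. x \<parallel> y) \<longrightarrow>
            (uninorm e (U5 e T R) \<longleftrightarrow>
              (\<forall>x\<in>incomparables e. \<forall>y\<in>{bot..<e}. x > y)))
       \<and> (\<forall>S F. t_conorm_on e top S \<longrightarrow> t_subnorm F \<longrightarrow>
            (\<forall>x\<in>incomparables e. \<forall>y\<in>{bot<..e}. x \<parallel> y) \<longrightarrow>
            (uninorm e (U6 e S F) \<longleftrightarrow>
              (\<forall>x\<in>incomparables e. \<forall>y\<in>{e<..top}. x < y)))"
proof (intro conjI allI impI)
  fix T R :: "'a \<Rightarrow> 'a \<Rightarrow> 'a"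
  assume "t_norm_on bot e T" "t_subconorm R"
    "\<forall>x\<in>incomparables e. \<forall>y\<in>{e..<top}. x \<parallel> y"
  then show "uninorm e (U5 e T R) \<longleftrightarrow> (\<forall>x\<in>incomparables e. \<forall>y\<in>{bot..<e}. x > y)"
    using uninorm_U5_iff \<open>e \<noteq> top\<close> by blast
next
  fix S F :: "'a \<Rightarrow> 'a \<Rightarrow> 'a"
  assume S: "t_conorm_on e top S" and F: "t_subnorm F"
    and par: "\<forall>x\<in>incomparables e. \<forall>y\<in>{bot<..e}. x \<parallel> y"
  \<comment> \<open>In the dual lattice \<open>top\<close> is \<open>dual bot\<close>, so
    \<open>e \<noteq> bot\<close> supplies the condition \<open>dual e \<noteq> top\<close>.\<close>
  have "uninorm (dual e) (U5 (dual e) (dual_op S) (dual_op F)) \<longleftrightarrow>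
      (\<forall>x\<in>incomparables (dual e). \<forall>y\<in>{bot..<dual e}. x > y)"
  proof (rule uninorm_U5_iff)
    show "dual e \<noteq> top"
      using \<open>e \<noteq> bot\<close> by (simp flip: dual_bot_eq)
    show "t_norm_on bot (dual e) (dual_op S)"
      using S by (simp add: t_norm_on_dual_op flip: dual_top_eq)
    show "t_subconorm (dual_op F)"
      using F by (simp add: t_subconorm_dual_op)
    show "\<forall>x\<in>incomparables (dual e). \<forall>y\<in>{dual e..<top}. x \<parallel> y"
      using par unfolding Ball_def all_dual[where 'a = 'a]
      by (simp only: dual_bot_eq[symmetric] dual_mem_interval dual_mem_incomparables
          incomparable_dual simp_thms)
  qed
  also have "\<dots> \<longleftrightarrow> (\<forall>x\<in>incomparables e. \<forall>y\<in>{e<..top}. x < y)"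
    unfolding Ball_def all_dual[where 'a = 'a]
    by (simp only: dual_top_eq[symmetric] dual_mem_interval dual_mem_incomparables less_dual_iff)
  finally show "uninorm e (U6 e S F) \<longleftrightarrow> (\<forall>x\<in>incomparables e. \<forall>y\<in>{e<..top}. x < y)"
    by (simp only: U5_dual_op uninorm_dual_op)
qed

end
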